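(* Let $N\ge 5$, $\beta>0$, and let $A$ be the circulant matrix generated by $a=(a_0,\dots,a_{N-1})\in\mathbb{R}^N$, with nonnegative entries. Set $\phi_j=\frac{2\pi j}{N}$ and assume that $A$ satisfies the cone condition $$\sum_{l=1}^{N-1}a_l\cos(\phi_l)\bigl(1-\cos(k\phi_l)\bigr)>0\qquad\text{for all }k\in\{1,\dots,N-1\}.$$ Let $d=\sum_{l=1}^{N-1}a_l$, $\rho=\sum_{l=1}^{N-1}a_l\cos(\phi_l)$ and $\tau^*:=(d-\rho)^{-1}$. Then there exists $\tau^{**}$ with $0<\tau^{**}\le\tau^*$ such that for all $0<\tau\le\tau^{**}$ and all $c\in\mathbb{S}$, the rotational twisted state $z_j(t)=r_j(t)e^{i\theta_j(t)}$ defined by $$\theta_j(t)=\phi_j+\omega t+c,\qquad r_j(t)=R,\qquad j\in\{1,\dots,N\},$$ with $$R:=\beta\sqrt{\tau\Bigl(\rho-d+\frac1\tau\Bigr)},\qquad \omega=\sum_{l=1}^{N-1}a_l\sin(\phi_l),$$ is linearly stable for the Stuart-Landau model $$\frac{d}{dt}z_j=\sum_{l=1}^N A_{jl}(z_l-z_j)+\frac1\tau\Bigl(1-\frac{|z_j|^2}{\beta^2}\Bigr)z_j,\qquad z_j\in\mathbb{C},\ j\in\{1,\dots,N\}.$$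
   Context: $\mathbb{S}=\mathbb{R}/2\pi\mathbb{Z}$. A matrix $A\in M_N(\mathbb{R})$ is circulant, generated by $a=(a_0,\dots,a_{N-1})$, if $A_{jl}=a_{(l-j)\bmod N}$ for all $j,l\in\{1,\dots,N\}$, with remainder in $\{0,\dots,N-1\}$ (symmetry is not assumed). Linear stability: writing $z_j=r_je^{i\theta_j}$ and passing to the frame rotating at speed $\omega$, the system becomes $$\dot r_j=\sum_l A_{jl}\bigl(\cos(\theta_l-\theta_j)r_l-r_j\bigr)+\tfrac1\tau\bigl(1-\tfrac{r_j^2}{\beta^2}\bigr)r_j,\qquad \dot\theta_j=-\omega+\sum_l A_{jl}\tfrac{r_l}{r_j}\sin(\theta_l-\theta_j),$$ for which $r_j=R$, $\theta_j=\phi_j+c$ is a fixed point. The rotational twisted state is linearly stable if the $2N\times 2N$ Jacobian of this system at the fixed point has $0$ as a simple eigenvalue (due to invariance under global rotation) and all other eigenvalues have strictly negative real part. *)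

theory Defs
  imports "HOL-Analysis.Derivative" "Jordan_Normal_Form.Char_Poly"
begin

(* Oscillators are numbered 1..N, so N x N matrices and N-tuples are functions on nat that are
   only read at indices in {1..N}; generators of circulant matrices are read at {0..N-1}. *)

definition circulant :: "nat \<Rightarrow> (nat \<Rightarrow> real) \<Rightarrow> (nat \<Rightarrow> nat \<Rightarrow> real) \<Rightarrow> bool" where
  "circulant N a A \<longleftrightarrow>
     (\<forall>j\<in>{1..N}. \<forall>l\<in>{1..N}. A j l = a (nat ((int l - int j) mod int N)))"

definition phase :: "nat \<Rightarrow> nat \<Rightarrow> real" where
  "phase N j = 2 * pi * real j / real N"

definition cone_condition :: "nat \<Rightarrow> (nat \<Rightarrow> real) \<Rightarrow> bool" where
  "cone_condition N a \<longleftrightarrow>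
     (\<forall>k\<in>{1..N-1}. (\<Sum>l=1..N-1. a l * cos (phase N l) * (1 - cos (real k * phase N l))) > 0)"

definition stuart_landau ::
  "nat \<Rightarrow> (nat \<Rightarrow> nat \<Rightarrow> real) \<Rightarrow> real \<Rightarrow> real \<Rightarrow> (nat \<Rightarrow> complex) \<Rightarrow> nat \<Rightarrow> complex" where
  "stuart_landau N A \<beta> \<tau> z j =
     (\<Sum>l=1..N. complex_of_real (A j l) * (z l - z j))
     + complex_of_real (1 / \<tau> * (1 - (cmod (z j))\<^sup>2 / \<beta>\<^sup>2)) * z j"

definition stuart_landau_solution ::
  "nat \<Rightarrow> (nat \<Rightarrow> nat \<Rightarrow> real) \<Rightarrow> real \<Rightarrow> real \<Rightarrow> (nat \<Rightarrow> real \<Rightarrow> complex) \<Rightarrow> bool" where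
  "stuart_landau_solution N A \<beta> \<tau> z \<longleftrightarrow>
     (\<forall>j\<in>{1..N}. \<forall>t. (z j has_vector_derivative stuart_landau N A \<beta> \<tau> (\<lambda>l. z l t) j) (at t))"

definition rotating_state ::
  "(nat \<Rightarrow> real) \<Rightarrow> (nat \<Rightarrow> real) \<Rightarrow> real \<Rightarrow> nat \<Rightarrow> real \<Rightarrow> complex" where
  "rotating_state r \<theta> \<omega> j t = complex_of_real (r j) * exp (\<i> * complex_of_real (\<theta> j + \<omega> * t))"

(* The Stuart-Landau system in polar coordinates, seen from the frame rotating at speed w.
   A state x has coordinates x 1, ..., x (2 * N): first the N radii, then the N angles. *)

definition polar_state :: "nat \<Rightarrow> (nat \<Rightarrow> real) \<Rightarrow> (nat \<Rightarrow> real) \<Rightarrow> nat \<Rightarrow> real" where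
  "polar_state N r \<theta> i = (if i \<le> N then r i else \<theta> (i - N))"

definition polar_field ::
  "nat \<Rightarrow> (nat \<Rightarrow> nat \<Rightarrow> real) \<Rightarrow> real \<Rightarrow> real \<Rightarrow> real \<Rightarrow> (nat \<Rightarrow> real) \<Rightarrow> nat \<Rightarrow> real" where
  "polar_field N A \<beta> \<tau> \<omega> x =
     (let r = (\<lambda>j. x j); \<theta> = (\<lambda>j. x (N + j)) in
      polar_state N
        (\<lambda>j. (\<Sum>l=1..N. A j l * (cos (\<theta> l - \<theta> j) * r l - r j))
             + 1 / \<tau> * (1 - (r j)\<^sup>2 / \<beta>\<^sup>2) * r j)
        (\<lambda>j. - \<omega> + (\<Sum>l=1..N. A j l * (r l / r j) * sin (\<theta> l - \<theta> j))))"

(* Coordinates are numbered from 1, matrix entries from 0.  The entries are taken complex so that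
   the spectrum below consists of all complex eigenvalues. *)

definition jacobian :: "nat \<Rightarrow> ((nat \<Rightarrow> real) \<Rightarrow> nat \<Rightarrow> real) \<Rightarrow> (nat \<Rightarrow> real) \<Rightarrow> complex mat" where
  "jacobian n F x =
     mat n n (\<lambda>(p, q). complex_of_real (deriv (\<lambda>s. F (x(Suc q := s)) (Suc p)) (x (Suc q))))"

(* The radii are required to be positive because polar coordinates, and the quotients r_l / r_j,
   make sense only away from the origin. *)

definition linearly_stable ::
  "nat \<Rightarrow> (nat \<Rightarrow> nat \<Rightarrow> real) \<Rightarrow> real \<Rightarrow> real \<Rightarrow> real \<Rightarrow> (nat \<Rightarrow> real) \<Rightarrow> (nat \<Rightarrow> real) \<Rightarrow> bool" where
  "linearly_stable N A \<beta> \<tau> \<omega> r \<theta> \<longleftrightarrow>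
     (let x = polar_state N r \<theta>; F = polar_field N A \<beta> \<tau> \<omega>; J = jacobian (2 * N) F x in
      (\<forall>j\<in>{1..N}. r j > 0) \<and>
      (\<forall>i\<in>{1..2 * N}. F x i = 0) \<and>
      order 0 (char_poly J) = 1 \<and>
      (\<forall>\<mu>. eigenvalue J \<mu> \<and> \<mu> \<noteq> 0 \<longrightarrow> Re \<mu> < 0))"

end

theory Submission
  imports Defs
begin

text \<open>
  At the twisted state every coefficient of the linearisation depends on the pair of oscillators
  $(j,l)$ only through $(l - j) \bmod N$, so the Jacobian consists of four circulant $N \times N$
  blocks, and the discrete Fourier transform diagonalises all four at once
  (\<open>circulant_mult_fourier\<close>).  The characteristic polynomial therefore factors into $N$ quadratics,
  one for each mode $k$ (\<open>char_poly_block_circulant\<close>).  With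
  $C_k = \sum_{l=0}^{N-1} a_l \cos\phi_l\, e^{ik\phi_l}$, $S_k = \sum_{l=0}^{N-1} a_l \sin\phi_l\, e^{ik\phi_l}$ and
  $p_k = C_k - C_0$, $q_k = S_k - S_0$, $m = 2/\tau - 2(d - \rho)$, the quadratic of mode $k$ is
  \[ (x - p_k + m)(x - p_k) + q_k^2 . \]

  Mode $0$ has $p_0 = q_0 = 0$ and contributes the roots $0$ (the rotational symmetry) and $-m$.  For
  $k \neq 0$ the cone condition says exactly $\mathrm{Re}\, p_k < 0$.  A root $x$ with
  $\mathrm{Re}\, x \ge 0$ would have $|x - p_k| \ge -\mathrm{Re}\, p_k$ and $|x - p_k + m| \ge m$,
  hence $|q_k|^2 \ge m \cdot (-\mathrm{Re}\, p_k)$; this is impossible once $m$ is large, that is, once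
  $\tau$ is small (\<open>slow_root_stable\<close>).  Physically, small $\tau$ forces the radii to relax
  quickly, and what remains in the limit is the phase dynamics, whose spectrum is $\{p_k\}$.

  The bound on $\tau$ uses one threshold $M > |q_k|^2 / (-\mathrm{Re}\, p_k)$ for all modes together.
\<close>

section \<open>Circulant sums and Fourier modes\<close>

lemma sum_cyclic_shift:
  fixes g :: "nat \<Rightarrow> 'a::comm_monoid_add" and j :: int
  assumes "N > 0"
  shows "(\<Sum>q<N. g (nat ((int q - j) mod int N))) = (\<Sum>m<N. g m)"
proof (rule sum.reindex_bij_betw)
  have less: "nat (i mod int N) < N" for i
    using assms by (simp add: nat_less_iff)
  show "bij_betw (\<lambda>q. nat ((int q - j) mod int N)) {..<N} {..<N}"
  proof (rule bij_betw_byWitness[where f' = "\<lambda>m. nat ((int m + j) mod int N)"])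
    show "\<forall>q\<in>{..<N}. nat ((int (nat ((int q - j) mod int N)) + j) mod int N) = q"
      using assms by (auto simp: mod_add_left_eq)
    show "\<forall>m\<in>{..<N}. nat ((int (nat ((int m + j) mod int N)) - j) mod int N) = m"
      using assms by (auto simp: mod_diff_left_eq)
  qed (use less in auto)
qed

lemma sum_cyclic_shift_from_1:
  fixes g :: "nat \<Rightarrow> 'a::comm_monoid_add"
  assumes "N > 0"
  shows "(\<Sum>l=1..N. g (nat ((int l - int j) mod int N))) = (\<Sum>m<N. g m)"
proof -
  have "(\<Sum>l=1..N. g (nat ((int l - int j) mod int N)))
      = (\<Sum>q<N. g (nat ((int (Suc q) - int j) mod int N)))"
    by (rule sum.reindex_bij_betw[symmetric, where h = Suc])
      (auto simp: bij_betw_def image_iff Suc_le_eq gr0_conv_Suc intro!: inj_onI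
        elim!: less_SucE)
  also have "\<dots> = (\<Sum>q<N. g (nat ((int q - (int j - 1)) mod int N)))"
    by (simp add: algebra_simps)
  finally show ?thesis
    using sum_cyclic_shift[OF assms, of g "int j - 1"] by simp
qed

text \<open>Phases are additive up to full turns.  This is what lets a function of $\phi_l - \phi_j$ be read
  off from the residue $(l - j) \bmod N$ alone.\<close>
lemma phase_diff_mod:
  assumes "N > 0"
  obtains t :: int
  where "phase N (nat ((int l - int j) mod int N)) = phase N l - phase N j - 2 * pi * of_int t"
proof
  let ?t = "(int l - int j) div int N"
  have "real (nat ((int l - int j) mod int N)) = of_int ((int l - int j) mod int N)"
    using assms by simp
  also have "\<dots> = real l - real j - of_int ?t * real N"
    by (simp add: minus_div_mult_eq_mod[symmetric])
  finally show "phase N (nat ((int l - int j) mod int N)) = phase N l - phase N j - 2 * pi * of_int ?t"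
    using assms by (simp add: phase_def diff_divide_distrib left_diff_distrib right_diff_distrib)
qed

lemma cis_phase_mod:
  assumes "N > 0"
  shows "cis (real k * phase N l)
       = cis (real k * phase N j) * cis (real k * phase N (nat ((int l - int j) mod int N)))"
proof -
  obtain t :: int where
    t: "phase N (nat ((int l - int j) mod int N)) = phase N l - phase N j - 2 * pi * of_int t"
    using phase_diff_mod[OF assms] by blast
  have "cis (real k * phase N j) * cis (real k * phase N (nat ((int l - int j) mod int N)))
      = cis (real k * phase N l) * cis (2 * pi * of_int (- int k * t))"
    unfolding t cis_mult by (simp add: algebra_simps)
  also have "cis (2 * pi * of_int (- int k * t)) = 1"
    by (rule cis_multiple_2pi) auto
  finally show ?thesis by simp
qed

lemma cos_sin_phase_mod:
  assumes "N > 0"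
  shows "cos (phase N l - phase N j) = cos (phase N (nat ((int l - int j) mod int N)))"
    and "sin (phase N l - phase N j) = sin (phase N (nat ((int l - int j) mod int N)))"
proof -
  have "cis (phase N l - phase N j) = cis (phase N (nat ((int l - int j) mod int N)))"
    using cis_phase_mod[OF assms, of 1 l j] by (simp add: cis_divide[symmetric])
  then show "cos (phase N l - phase N j) = cos (phase N (nat ((int l - int j) mod int N)))"
    and "sin (phase N l - phase N j) = sin (phase N (nat ((int l - int j) mod int N)))"
    by (simp_all add: complex_eq_iff)
qed

text \<open>The diagonal of a circulant matrix is residue $0$.  The left side is written with \<open>\<le>\<close> because
  this is the simplifier's normal form of \<open>nat \<dots> = 0\<close>.\<close>
lemma shift_eq_0_iff:
  assumes "p < N" "q < N"
  shows "(int q - int p) mod int N \<le> 0 \<longleftrightarrow> p = q"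
proof -
  have "(int q - int p) mod int N \<le> 0 \<longleftrightarrow> (int q - int p) mod int N = 0"
    using assms pos_mod_sign[of "int N" "int q - int p"] by linarith
  also have "\<dots> \<longleftrightarrow> int q mod int N = int p mod int N"
    by (simp add: mod_eq_dvd_iff dvd_eq_mod_eq_0)
  finally show ?thesis using assms by auto
qed

lemma phase_0 [simp]: "phase N 0 = 0"
  by (simp add: phase_def)

definition circulant_mat :: "nat \<Rightarrow> (nat \<Rightarrow> complex) \<Rightarrow> complex mat" where
  "circulant_mat N b = mat N N (\<lambda>(p, q). b (nat ((int q - int p) mod int N)))"

definition fourier_mat :: "nat \<Rightarrow> complex mat" where
  "fourier_mat N = mat N N (\<lambda>(p, k). cis (real k * phase N p))"

text \<open>The eigenvalue of the circulant matrix generated by \<open>b\<close> on the $k$-th Fourier mode.\<close>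
definition circulant_symbol :: "nat \<Rightarrow> (nat \<Rightarrow> complex) \<Rightarrow> nat \<Rightarrow> complex" where
  "circulant_symbol N b k = (\<Sum>m<N. b m * cis (real k * phase N m))"

lemma circulant_mat_index [simp]:
  "p < N \<Longrightarrow> q < N \<Longrightarrow> circulant_mat N b $$ (p, q) = b (nat ((int q - int p) mod int N))"
  by (simp add: circulant_mat_def)

lemma circulant_mat_dim [simp]: "dim_row (circulant_mat N b) = N" "dim_col (circulant_mat N b) = N"
  by (simp_all add: circulant_mat_def)

lemma circulant_mat_carrier [simp]: "circulant_mat N b \<in> carrier_mat N N"
  by (simp add: circulant_mat_def)

lemma fourier_mat_carrier [simp]: "fourier_mat N \<in> carrier_mat N N"
  by (simp add: fourier_mat_def)

lemma circulant_mult_fourier: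
  "circulant_mat N b * fourier_mat N = fourier_mat N * mat_diag N (circulant_symbol N b)"
proof (rule eq_matI)
  fix p k
  assume "p < dim_row (fourier_mat N * mat_diag N (circulant_symbol N b))"
    and "k < dim_col (fourier_mat N * mat_diag N (circulant_symbol N b))"
  then have p: "p < N" and k: "k < N" by (auto simp: fourier_mat_def mat_diag_def)
  then have N: "N > 0" by simp
  let ?m = "\<lambda>q. nat ((int q - int p) mod int N)"
  have "(circulant_mat N b * fourier_mat N) $$ (p, k)
      = (\<Sum>q<N. b (?m q) * cis (real k * phase N q))"
    using p k by (simp add: circulant_mat_def fourier_mat_def scalar_prod_def atLeast0LessThan)
  also have "\<dots> = (\<Sum>q<N. cis (real k * phase N p) * (b (?m q) * cis (real k * phase N (?m q))))"
    by (intro sum.cong refl, subst cis_phase_mod[OF N, of k _ p]) simp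
  also have "\<dots> = cis (real k * phase N p) * (\<Sum>m<N. b m * cis (real k * phase N m))"
    unfolding sum_distrib_left[symmetric]
    using sum_cyclic_shift[OF N, of "\<lambda>m. b m * cis (real k * phase N m)" "int p"] by simp
  also have "\<dots> = (fourier_mat N * mat_diag N (circulant_symbol N b)) $$ (p, k)"
    using p k by (subst mat_diag_mult_right[OF fourier_mat_carrier])
      (simp add: fourier_mat_def circulant_symbol_def)
  finally show "(circulant_mat N b * fourier_mat N) $$ (p, k)
      = (fourier_mat N * mat_diag N (circulant_symbol N b)) $$ (p, k)" .
qed (auto simp: circulant_mat_def fourier_mat_def mat_diag_def)

text \<open>A geometric sum whose ratio is a nontrivial $N$-th root of unity.\<close>
lemma sum_cis_phase:
  assumes "k < N" "k' < N" "k \<noteq> k'"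
  shows "(\<Sum>p<N. cis ((real k - real k') * phase N p)) = 0"
proof -
  let ?w = "cis ((real k - real k') * phase N 1)"
  have N: "real N > 0" using assms by simp
  have "?w \<noteq> 1"
  proof
    assume "?w = 1"
    then have "cos ((real k - real k') * phase N 1) = 1"
      by (simp add: complex_eq_iff)
    then obtain t :: int where "(real k - real k') * phase N 1 = of_int t * 2 * pi"
      using cos_one_2pi_int by auto
    then have "(2 * pi) * (real k - real k') = (2 * pi) * (of_int t * real N)"
      using N by (simp add: phase_def field_simps)
    then have "real k - real k' = of_int t * real N"
      by (subst (asm) mult_cancel_left) simp
    then have "real_of_int (int k - int k') = of_int (t * int N)" by simp
    then have eq: "int k - int k' = t * int N" by (simp only: of_int_eq_iff)
    then have "int N dvd int k - int k'" by simp
    then have "int N \<le> \<bar>int k - int k'\<bar>"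
      using assms(3) by (intro zdvd_imp_le) (auto simp: dvd_abs_iff)
    then show False using assms by linarith
  qed
  moreover have "?w ^ N = 1"
  proof -
    have "real N * ((real k - real k') * phase N 1) = 2 * pi * of_int (int k - int k')"
      using N by (simp add: phase_def)
    then have "?w ^ N = cis (2 * pi * of_int (int k - int k'))"
      by (simp only: DeMoivre)
    also have "\<dots> = 1" by (rule cis_multiple_2pi) auto
    finally show ?thesis .
  qed
  moreover have "(\<Sum>p<N. cis ((real k - real k') * phase N p)) = (\<Sum>p<N. ?w ^ p)"
    by (intro sum.cong refl) (simp add: DeMoivre phase_def field_simps)
  ultimately show ?thesis by (simp add: geometric_sum)
qed

text \<open>The Fourier modes are orthogonal, so the conjugate transpose inverts the matrix up to the
  factor $N$.\<close>
lemma det_fourier_mat: "det (fourier_mat N) \<noteq> 0"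
proof (cases "N = 0")
  case True
  then show ?thesis by (simp add: fourier_mat_def det_dim_zero)
next
  case False
  define V where "V = mat N N (\<lambda>(k', p). cis (- (real k' * phase N p)))"
  have V: "V \<in> carrier_mat N N" by (simp add: V_def)
  have "V * fourier_mat N = of_nat N \<cdot>\<^sub>m 1\<^sub>m N"
  proof (rule eq_matI)
    fix k' k assume "k' < dim_row (of_nat N \<cdot>\<^sub>m 1\<^sub>m N :: complex mat)"
      and "k < dim_col (of_nat N \<cdot>\<^sub>m 1\<^sub>m N :: complex mat)"
    then have kk: "k' < N" "k < N" by auto
    then have "(V * fourier_mat N) $$ (k', k) = (\<Sum>p<N. cis ((real k - real k') * phase N p))"
      by (simp add: V_def fourier_mat_def scalar_prod_def atLeast0LessThan cis_mult algebra_simps)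
    also have "\<dots> = (of_nat N \<cdot>\<^sub>m 1\<^sub>m N) $$ (k', k)"
      using kk sum_cis_phase[of k N k'] by auto
    finally show "(V * fourier_mat N) $$ (k', k) = (of_nat N \<cdot>\<^sub>m 1\<^sub>m N) $$ (k', k)" .
  qed (auto simp: V_def fourier_mat_def)
  then have "det V * det (fourier_mat N) = of_nat N ^ N"
    using det_mult[OF V fourier_mat_carrier] by simp
  then show ?thesis using False by auto
qed

section \<open>The spectrum of a matrix with circulant blocks\<close>

lemma eq_four_blockI:
  assumes M: "M \<in> carrier_mat (N + N) (N + N)"
    and "A \<in> carrier_mat N N" "B \<in> carrier_mat N N" "C \<in> carrier_mat N N" "D \<in> carrier_mat N N"
    and "\<And>p q. p < N \<Longrightarrow> q < N \<Longrightarrow> M $$ (p, q) = A $$ (p, q)"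
    and "\<And>p q. p < N \<Longrightarrow> q < N \<Longrightarrow> M $$ (p, N + q) = B $$ (p, q)"
    and "\<And>p q. p < N \<Longrightarrow> q < N \<Longrightarrow> M $$ (N + p, q) = C $$ (p, q)"
    and "\<And>p q. p < N \<Longrightarrow> q < N \<Longrightarrow> M $$ (N + p, N + q) = D $$ (p, q)"
  shows "M = four_block_mat A B C D"
proof (rule eq_matI)
  fix p q assume "p < dim_row (four_block_mat A B C D)" "q < dim_col (four_block_mat A B C D)"
  then have pq: "p < N + N" "q < N + N" using assms(2,5) by auto
  consider "p < N" "q < N" | q' where "p < N" "q = N + q'" "q' < N"
    | p' where "q < N" "p = N + p'" "p' < N"
    | p' q' where "p = N + p'" "p' < N" "q = N + q'" "q' < N"
    using pq by (metis add_less_cancel_left le_Suc_ex not_less)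
  then show "M $$ (p, q) = four_block_mat A B C D $$ (p, q)"
    by cases (use assms in auto)
qed (use assms in auto)

text \<open>Conjugation by the block matrix $\mathrm{diag}(U, U)$, with $U$ the Fourier matrix, makes all four
  blocks diagonal.  Diagonal blocks commute, so the determinant is that of the $N \times N$ diagonal
  matrix of $2 \times 2$ determinants.\<close>
lemma det_block_circulant:
  "det (four_block_mat (circulant_mat N e) (circulant_mat N f) (circulant_mat N g) (circulant_mat N h))
   = (\<Prod>k<N. circulant_symbol N e k * circulant_symbol N h k
            - circulant_symbol N f k * circulant_symbol N g k)"
proof -
  let ?K = "four_block_mat (circulant_mat N e) (circulant_mat N f) (circulant_mat N g) (circulant_mat N h)"
  let ?U = "fourier_mat N" and ?Z = "0\<^sub>m N N :: complex mat"
  let ?UU = "four_block_mat ?U ?Z ?Z ?U"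
  let ?D = "\<lambda>b. mat_diag N (circulant_symbol N b)"
  let ?DD = "four_block_mat (?D e) (?D f) (?D g) (?D h)"
  note c = circulant_mat_carrier fourier_mat_carrier mat_diag_dim zero_carrier_mat
  have "?K * ?UU = ?UU * ?DD"
    by (simp add: mult_four_block_mat[OF c(1) c(1) c(1) c(1) c(2) c(4) c(4) c(2)]
        mult_four_block_mat[OF c(2) c(4) c(4) c(2) c(3) c(3) c(3) c(3)]
        circulant_mult_fourier right_add_zero_mat[of _ N N] left_add_zero_mat[of _ N N]
        mult_carrier_mat[OF c(2) c(3)] left_mult_zero_mat[OF c(3)] right_mult_zero_mat[OF c(1)])
  then have "det ?K * det ?UU = det ?UU * det ?DD"
    by (metis c det_mult four_block_carrier_mat)
  moreover have "det ?UU \<noteq> 0"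
    using det_fourier_mat by (subst det_four_block_mat_upper_right_zero[OF c(2) refl c(4) c(2)]) simp
  ultimately have "det ?K = det ?DD" by simp
  also have "\<dots> = det (?D e * ?D h - ?D f * ?D g)"
    by (rule det_four_block_mat[OF c(3) c(3) c(3) c(3)]) (simp add: mult.commute)
  also have "?D e * ?D h - ?D f * ?D g = mat_diag N (\<lambda>k. circulant_symbol N e k * circulant_symbol N h k
            - circulant_symbol N f k * circulant_symbol N g k)"
    unfolding mat_diag_diag by (rule eq_matI) (auto simp: mat_diag_def)
  also have "det \<dots> = (\<Prod>k<N. circulant_symbol N e k * circulant_symbol N h k
            - circulant_symbol N f k * circulant_symbol N g k)"
    by (subst det_upper_triangular[where n = N])
      (auto simp: mat_diag_def upper_triangular_def prod_list_diag_prod atLeast0LessThan)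
  finally show ?thesis .
qed

text \<open>Subtracting the matrix from $x$ times the identity keeps its blocks circulant, so the previous
  determinant formula applies at every $x$; polynomials that agree at all complex points are equal.\<close>
lemma char_poly_block_circulant:
  fixes e f g h :: "nat \<Rightarrow> complex"
  shows "char_poly (four_block_mat (circulant_mat N e) (circulant_mat N f) (circulant_mat N g) (circulant_mat N h))
   = (\<Prod>k<N. [:- circulant_symbol N e k, 1:] * [:- circulant_symbol N h k, 1:]
            - [:circulant_symbol N f k * circulant_symbol N g k:])" (is "char_poly ?J = ?P")
proof -
  have "poly (char_poly ?J) x = poly ?P x" for x
  proof -
    let ?s = "\<lambda>b m. (if m = 0 then x else 0) - b m" and ?n = "\<lambda>b m. - b m"
    have J: "?J \<in> carrier_mat (N + N) (N + N)" by (intro four_block_carrier_mat) simp_all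
    have "poly (char_poly ?J) x = det (- char_matrix ?J x)"
      by (rule char_poly_matrix[OF J])
    also have "- char_matrix ?J x = four_block_mat (circulant_mat N (?s e)) (circulant_mat N (?n f))
        (circulant_mat N (?n g)) (circulant_mat N (?s h))"
      using J by (intro eq_four_blockI[where N = N]) (auto simp: char_matrix_def shift_eq_0_iff)
    also have "det \<dots> = (\<Prod>k<N. circulant_symbol N (?s e) k * circulant_symbol N (?s h) k
            - circulant_symbol N (?n f) k * circulant_symbol N (?n g) k)"
      by (rule det_block_circulant)
    also have "\<dots> = (\<Prod>k<N. (x - circulant_symbol N e k) * (x - circulant_symbol N h k)
            - circulant_symbol N f k * circulant_symbol N g k)"
    proof (rule prod.cong[OF refl])
      fix k assume "k \<in> {..<N}"
      then have N: "0 < N" by simp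
      have s: "circulant_symbol N (?s b) k = x - circulant_symbol N b k" for b
        using N by (simp add: circulant_symbol_def left_diff_distrib sum_subtractf if_distrib[of "\<lambda>z. z * _"]
            cong: if_cong)
      have n: "circulant_symbol N (?n b) k = - circulant_symbol N b k" for b
        by (simp add: circulant_symbol_def sum_negf)
      show "circulant_symbol N (?s e) k * circulant_symbol N (?s h) k
            - circulant_symbol N (?n f) k * circulant_symbol N (?n g) k
          = (x - circulant_symbol N e k) * (x - circulant_symbol N h k)
            - circulant_symbol N f k * circulant_symbol N g k"
        by (simp only: s n minus_mult_minus)
    qed
    also have "\<dots> = poly ?P x" by (simp add: poly_prod algebra_simps)
    finally show ?thesis .
  qed
  then show ?thesis by (simp add: poly_eq_poly_eq_iff[symmetric] fun_eq_iff)
qed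

lemma order_0_simple_root:
  fixes p r :: "complex poly"
  assumes "p = [:0, 1:] * r" "poly r 0 \<noteq> 0"
  shows "order 0 p = 1"
proof -
  have "p \<noteq> 0" using assms by auto
  moreover have "order 0 [:0, 1 :: complex:] = 1"
    using order_power_n_n[of "0::complex" 1] by simp
  ultimately show ?thesis
    using assms order_0I[of r 0] by (simp add: order_mult del: mult_pCons_left)
qed

text \<open>Both factors of the product are bounded below on the closed right half-plane, so the product is
  too large there to be $-q^2$.\<close>
lemma slow_root_stable:
  fixes p q x :: complex and m :: real
  assumes "m > 0" "Re p < 0" and gap: "(cmod q)\<^sup>2 < m * (- Re p)"
    and root: "(x - p + of_real m) * (x - p) + q\<^sup>2 = 0"
  shows "Re x < 0"
proof (rule ccontr)
  assume "\<not> Re x < 0"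
  then have re: "Re (x - p) \<ge> - Re p" by simp
  have "- Re p \<le> cmod (x - p)"
    using re complex_Re_le_cmod[of "x - p"] by linarith
  moreover have "m \<le> cmod (x - p + of_real m)"
    using re assms(2) complex_Re_le_cmod[of "x - p + of_real m"] by simp
  ultimately have "m * (- Re p) \<le> cmod (x - p + of_real m) * cmod (x - p)"
    using assms by (intro mult_mono) auto
  also have "\<dots> = cmod ((x - p + of_real m) * (x - p))" by (simp add: norm_mult)
  also have "(x - p + of_real m) * (x - p) = - (q\<^sup>2)"
    using root by (simp add: eq_neg_iff_add_eq_0)
  also have "cmod (- (q\<^sup>2)) = (cmod q)\<^sup>2" by (simp add: norm_power)
  finally show False using gap by simp
qed

text \<open>Mode $0$ gives the simple root $0$ and the root $-m$; by the preceding lemma no other mode has a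
  root in the closed right half-plane, and in particular none vanishes at $0$.\<close>
lemma spectrum_of_modes:
  fixes J :: "complex mat" and p q :: "nat \<Rightarrow> complex" and m :: real
  assumes J: "J \<in> carrier_mat n n" and "N > 0" and "m > 0"
    and cp: "char_poly J = (\<Prod>k<N. [:- (p k - of_real m), 1:] * [:- p k, 1:] + [:(q k)\<^sup>2:])"
    and zero: "p 0 = 0" "q 0 = 0"
    and stable: "\<forall>k\<in>{1..N-1}. Re (p k) < 0 \<and> (cmod (q k))\<^sup>2 < m * (- Re (p k))"
  shows "order 0 (char_poly J) = 1"
    and "eigenvalue J \<mu> \<Longrightarrow> \<mu> \<noteq> 0 \<Longrightarrow> Re \<mu> < 0"
proof -
  define Q where "Q k = [:- (p k - of_real m), 1:] * [:- p k, 1:] + [:(q k)\<^sup>2:]" for k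
  have Q: "poly (Q k) x = (x - p k + of_real m) * (x - p k) + (q k)\<^sup>2" for k x
    by (simp add: Q_def algebra_simps)
  have nz: "Re x < 0" if "poly (Q k) x = 0" "k \<in> {1..N-1}" for k x
    using slow_root_stable[OF \<open>m > 0\<close>, of "p k" "q k" x] that stable Q by auto
  have split: "{..<N} = insert 0 {1..N-1}" using \<open>N > 0\<close> by auto
  have Q0: "Q 0 = [:0, 1:] * [:of_real m, 1:]" by (simp add: Q_def zero)
  have cp': "char_poly J = [:0, 1:] * ([:of_real m, 1:] * (\<Prod>k=1..N-1. Q k))"
    unfolding cp Q_def[symmetric] split by (simp add: Q0 mult.assoc del: mult_pCons_left)
  have "poly (Q k) 0 \<noteq> 0" if "k \<in> {1..N-1}" for k
    using nz[OF _ that, of 0] by auto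
  then have rest: "(\<Prod>k=1..N-1. poly (Q k) 0) \<noteq> 0" by simp
  show "order 0 (char_poly J) = 1"
  proof (rule order_0_simple_root[OF cp'])
    show "poly ([:of_real m, 1:] * (\<Prod>k=1..N-1. Q k)) 0 \<noteq> 0"
      using rest \<open>m > 0\<close> by (simp add: poly_prod)
  qed
  show "Re \<mu> < 0" if "eigenvalue J \<mu>" "\<mu> \<noteq> 0"
  proof -
    have "poly (char_poly J) \<mu> = 0" using that eigenvalue_root_char_poly[OF J] by simp
    then have "\<mu> * ((of_real m + \<mu>) * (\<Prod>k=1..N-1. poly (Q k) \<mu>)) = 0"
      unfolding cp' by (simp add: poly_prod algebra_simps)
    then have "of_real m + \<mu> = 0 \<or> (\<exists>k\<in>{1..N-1}. poly (Q k) \<mu> = 0)"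
      using \<open>\<mu> \<noteq> 0\<close> by simp
    then show ?thesis
    proof
      assume "of_real m + \<mu> = 0"
      then have "\<mu> = - of_real m" by (simp add: eq_neg_iff_add_eq_0 add.commute)
      then show ?thesis using \<open>m > 0\<close> by simp
    qed (use nz in blast)
  qed
qed

section \<open>The twisted state and its Jacobian\<close>

lemma circulant_entry:
  assumes "circulant N a A" "j \<in> {1..N}" "l \<in> {1..N}"
  shows "A j l = a (nat ((int l - int j) mod int N))"
  using assms by (auto simp: circulant_def)

lemma circulant_row_sum:
  fixes G :: "real \<Rightarrow> real \<Rightarrow> real \<Rightarrow> 'b::comm_monoid_add"
  assumes "circulant N a A" "j \<in> {1..N}"
  shows "(\<Sum>l=1..N. G (A j l) (cos (phase N l - phase N j)) (sin (phase N l - phase N j)))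
       = (\<Sum>m<N. G (a m) (cos (phase N m)) (sin (phase N m)))"
proof -
  have N: "N > 0" using assms(2) by simp
  have "(\<Sum>l=1..N. G (A j l) (cos (phase N l - phase N j)) (sin (phase N l - phase N j)))
      = (\<Sum>l=1..N. (\<lambda>m. G (a m) (cos (phase N m)) (sin (phase N m)))
            (nat ((int l - int j) mod int N)))"
    by (intro sum.cong refl)
      (simp add: circulant_entry[OF assms] cos_sin_phase_mod[OF N])
  then show ?thesis
    using sum_cyclic_shift_from_1[OF N, of "\<lambda>m. G (a m) (cos (phase N m)) (sin (phase N m))" j] by simp
qed

lemma sum_lessThan_split_0:
  fixes g :: "nat \<Rightarrow> 'a::comm_monoid_add"
  assumes "N > 0"
  shows "(\<Sum>m<N. g m) = g 0 + (\<Sum>m=1..N-1. g m)"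
proof -
  have "{..<N} = insert 0 {1..N-1}" using assms by auto
  then show ?thesis by simp
qed

text \<open>On the twisted state the coupling term is $z_j$ times the row-independent number
  $\rho - d + i\omega$.  The assumption \<open>balance\<close> is the amplitude equation for $R$: the local growth
  rate compensates $\rho - d$, and only the rotation $i \omega$ is left.\<close>
lemma twisted_state_solution:
  assumes "circulant N a A"
    and balance: "1 / \<tau> * (1 - R\<^sup>2 / \<beta>\<^sup>2) = (\<Sum>l=1..N-1. a l) - (\<Sum>l=1..N-1. a l * cos (phase N l))"
    and \<omega>: "\<omega> = (\<Sum>l=1..N-1. a l * sin (phase N l))"
  shows "stuart_landau_solution N A \<beta> \<tau> (rotating_state (\<lambda>j. R) (\<lambda>j. phase N j + c) \<omega>)"
  unfolding stuart_landau_solution_def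
proof (intro ballI allI)
  fix j t assume j: "j \<in> {1..N}"
  then have N: "N > 0" by simp
  let ?z = "\<lambda>l. rotating_state (\<lambda>j. R) (\<lambda>j. phase N j + c) \<omega> l"
  have z: "?z l t = ?z j t * Complex (cos (phase N l - phase N j)) (sin (phase N l - phase N j))" for l
  proof -
    have polar: "?z l t = of_real R * cis (phase N l + c + \<omega> * t)" for l
      by (simp add: rotating_state_def cis_conv_exp)
    have "cis (phase N l + c + \<omega> * t) = cis (phase N j + c + \<omega> * t) * cis (phase N l - phase N j)"
      by (simp add: cis_mult algebra_simps)
    then show ?thesis by (simp only: polar cis.ctr mult.assoc)
  qed
  have "(\<Sum>l=1..N. of_real (A j l) * (?z l t - ?z j t))
      = (\<Sum>l=1..N. ?z j t * (of_real (A j l) *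
            (Complex (cos (phase N l - phase N j)) (sin (phase N l - phase N j)) - 1)))"
  proof (intro sum.cong refl)
    fix l
    show "of_real (A j l) * (?z l t - ?z j t) = ?z j t * (of_real (A j l) *
            (Complex (cos (phase N l - phase N j)) (sin (phase N l - phase N j)) - 1))"
      unfolding z[of l] by (simp only: algebra_simps mult_1_left)
  qed
  also have "\<dots> = ?z j t * (\<Sum>m<N. of_real (a m) * (Complex (cos (phase N m)) (sin (phase N m)) - 1))"
    unfolding sum_distrib_left[symmetric]
    by (subst circulant_row_sum[OF assms(1) j, of "\<lambda>x c s. of_real x * (Complex c s - 1)"]) simp
  also have "(\<Sum>m<N. of_real (a m) * (Complex (cos (phase N m)) (sin (phase N m)) - 1))
      = Complex ((\<Sum>l=1..N-1. a l * cos (phase N l)) - (\<Sum>l=1..N-1. a l)) \<omega>"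
    by (simp add: sum_lessThan_split_0[OF N] \<omega> complex_eq_iff sum_subtractf[symmetric]
        right_diff_distrib)
  finally have coupling: "(\<Sum>l=1..N. of_real (A j l) * (?z l t - ?z j t))
      = ?z j t * Complex ((\<Sum>l=1..N-1. a l * cos (phase N l)) - (\<Sum>l=1..N-1. a l)) \<omega>" .
  have "cmod (?z j t) = \<bar>R\<bar>"
    by (simp add: rotating_state_def norm_mult flip: cis_conv_exp)
  then have "1 / \<tau> * (1 - (cmod (?z j t))\<^sup>2 / \<beta>\<^sup>2)
      = (\<Sum>l=1..N-1. a l) - (\<Sum>l=1..N-1. a l * cos (phase N l))"
    using balance by simp
  then have "stuart_landau N A \<beta> \<tau> (\<lambda>l. ?z l t) j
      = ?z j t * Complex ((\<Sum>l=1..N-1. a l * cos (phase N l)) - (\<Sum>l=1..N-1. a l)) \<omega>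
        + of_real ((\<Sum>l=1..N-1. a l) - (\<Sum>l=1..N-1. a l * cos (phase N l))) * ?z j t"
    unfolding stuart_landau_def coupling by metis
  also have "\<dots> = \<i> * of_real \<omega> * ?z j t"
    by (simp add: complex_eq_iff algebra_simps)
  finally have field: "stuart_landau N A \<beta> \<tau> (\<lambda>l. ?z l t) j = \<i> * of_real \<omega> * ?z j t" .
  have "((\<lambda>u. of_real R * exp (\<i> * (of_real (phase N j + c) + of_real \<omega> * u))) has_field_derivative
      \<i> * of_real \<omega> * ?z j t) (at (of_real t))"
    by (auto intro!: derivative_eq_intros simp: rotating_state_def)
  from has_vector_derivative_real_field[OF this]
  show "(?z j has_vector_derivative stuart_landau N A \<beta> \<tau> (\<lambda>l. ?z l t) j) (at t)"
    unfolding field by (simp add: rotating_state_def[abs_def])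
qed

text \<open>The chain rule along an arbitrary curve \<open>y\<close> of states.  Partial derivatives are the case where one
  coordinate moves, and keeping \<open>y'\<close> abstract treats radii and angles alike.\<close>
lemma polar_field_radius_derivative:
  assumes y: "\<And>n. (y n has_real_derivative y' n) (at s)" and "j \<le> N"
  shows "((\<lambda>s. polar_field N A \<beta> \<tau> \<omega> (\<lambda>n. y n s) j) has_real_derivative
    (\<Sum>l=1..N. A j l * (cos (y (N + l) s - y (N + j) s) * y' l
        - sin (y (N + l) s - y (N + j) s) * (y' (N + l) - y' (N + j)) * y l s - y' j))
    + 1 / \<tau> * (1 - 3 * (y j s)\<^sup>2 / \<beta>\<^sup>2) * y' j) (at s)"
proof -
  have cubic: "((\<lambda>s. 1 / \<tau> * (1 - (y j s)\<^sup>2 / \<beta>\<^sup>2) * y j s) has_real_derivative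
      1 / \<tau> * (1 - 3 * (y j s)\<^sup>2 / \<beta>\<^sup>2) * y' j) (at s)"
    unfolding divide_inverse power2_eq_square
    by (rule y derivative_eq_intros refl)+ (simp add: algebra_simps)
  have "((\<lambda>s. \<Sum>l=1..N. A j l * (cos (y (N + l) s - y (N + j) s) * y l s - y j s)) has_real_derivative
    (\<Sum>l=1..N. A j l * (cos (y (N + l) s - y (N + j) s) * y' l
        - sin (y (N + l) s - y (N + j) s) * (y' (N + l) - y' (N + j)) * y l s - y' j))) (at s)"
    by (intro DERIV_sum) ((rule y derivative_eq_intros refl)+, simp add: algebra_simps)
  from DERIV_add[OF this cubic] show ?thesis
    using \<open>j \<le> N\<close> by (simp add: polar_field_def polar_state_def)
qed

lemma polar_field_angle_derivative:
  assumes y: "\<And>n. (y n has_real_derivative y' n) (at s)" and "j \<ge> 1" and "y j s \<noteq> 0"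
  shows "((\<lambda>s. polar_field N A \<beta> \<tau> \<omega> (\<lambda>n. y n s) (N + j)) has_real_derivative
    (\<Sum>l=1..N. A j l * ((y' l * y j s - y l s * y' j) / (y j s * y j s) * sin (y (N + l) s - y (N + j) s)
        + y l s / y j s * (cos (y (N + l) s - y (N + j) s) * (y' (N + l) - y' (N + j)))))) (at s)"
proof -
  have "((\<lambda>s. - \<omega> + (\<Sum>l=1..N. A j l * (y l s / y j s) * sin (y (N + l) s - y (N + j) s)))
    has_real_derivative 0 + (\<Sum>l=1..N. A j l * ((y' l * y j s - y l s * y' j) / (y j s * y j s) * sin (y (N + l) s - y (N + j) s)
        + y l s / y j s * (cos (y (N + l) s - y (N + j) s) * (y' (N + l) - y' (N + j)))))) (at s)"
    by (intro DERIV_add DERIV_const DERIV_sum)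
      ((rule y \<open>y j s \<noteq> 0\<close> derivative_eq_intros refl)+, simp add: algebra_simps)
  then show ?thesis using \<open>j \<ge> 1\<close> by (simp add: polar_field_def polar_state_def)
qed

lemma coordinate_derivative:
  fixes x :: "nat \<Rightarrow> real"
  shows "((\<lambda>s. (x(i := s)) n) has_real_derivative (if n = i then 1 else 0)) (at (x i))"
  by (cases "n = i") (auto intro!: derivative_eq_intros)

lemma polar_field_radius_partial:
  fixes x :: "nat \<Rightarrow> real"
  defines "\<delta> \<equiv> \<lambda>i n. if n = i then 1 else (0::real)"
  assumes "j \<le> N"
  shows "deriv (\<lambda>s. polar_field N A \<beta> \<tau> \<omega> (x(i := s)) j) (x i) =
    (\<Sum>l=1..N. A j l * (cos (x (N + l) - x (N + j)) * \<delta> i l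
        - sin (x (N + l) - x (N + j)) * (\<delta> i (N + l) - \<delta> i (N + j)) * x l - \<delta> i j))
    + 1 / \<tau> * (1 - 3 * (x j)\<^sup>2 / \<beta>\<^sup>2) * \<delta> i j"
  using polar_field_radius_derivative[of "\<lambda>n s. (x(i := s)) n" "\<delta> i" "x i" j N A \<beta> \<tau> \<omega>]
    coordinate_derivative[of x i] assms(2)
  by (intro DERIV_imp_deriv) (simp add: \<delta>_def del: fun_upd_apply)

lemma polar_field_angle_partial:
  fixes x :: "nat \<Rightarrow> real"
  defines "\<delta> \<equiv> \<lambda>i n. if n = i then 1 else (0::real)"
  assumes "j \<ge> 1" "x j \<noteq> 0"
  shows "deriv (\<lambda>s. polar_field N A \<beta> \<tau> \<omega> (x(i := s)) (N + j)) (x i) =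
    (\<Sum>l=1..N. A j l * ((\<delta> i l * x j - x l * \<delta> i j) / (x j * x j) * sin (x (N + l) - x (N + j))
        + x l / x j * (cos (x (N + l) - x (N + j)) * (\<delta> i (N + l) - \<delta> i (N + j)))))"
  using polar_field_angle_derivative[of "\<lambda>n s. (x(i := s)) n" "\<delta> i" "x i" j N A \<beta> \<tau> \<omega>]
    coordinate_derivative[of x i] assms(2,3)
  by (intro DERIV_imp_deriv) (simp add: \<delta>_def del: fun_upd_apply)

text \<open>Besides the coupling terms, which are circulant with generators $a_m \cos\phi_m$ and
  $\pm a_m \sin\phi_m$, each diagonal entry collects the whole row sum with the opposite sign.  These
  row sums do not depend on the row, so the correction sits at residue $0$ of the generator.  The
  self-coupling $a_0$ enters generator and row sum alike and cancels.\<close>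
lemma twisted_state_jacobian:
  fixes N :: nat and a :: "nat \<Rightarrow> real" and A :: "nat \<Rightarrow> nat \<Rightarrow> real" and \<beta> \<tau> \<omega> c R :: real
  defines "x \<equiv> polar_state N (\<lambda>j. R) (\<lambda>j. phase N j + c)"
    and "E \<equiv> 1 / \<tau> * (1 - 3 * R\<^sup>2 / \<beta>\<^sup>2) - (\<Sum>m<N. a m)"
    and "P \<equiv> (\<Sum>m<N. a m * cos (phase N m))"
    and "W \<equiv> (\<Sum>m<N. a m * sin (phase N m))"
  assumes circ: "circulant N a A" and R: "R > 0"
  shows "jacobian (2 * N) (polar_field N A \<beta> \<tau> \<omega>) x = four_block_mat
    (circulant_mat N (\<lambda>m. of_real (a m * cos (phase N m) + (if m = 0 then E else 0))))
    (circulant_mat N (\<lambda>m. of_real (- R * (a m * sin (phase N m)) + (if m = 0 then R * W else 0))))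
    (circulant_mat N (\<lambda>m. of_real (1 / R * (a m * sin (phase N m)) + (if m = 0 then - W / R else 0))))
    (circulant_mat N (\<lambda>m. of_real (a m * cos (phase N m) + (if m = 0 then - P else 0))))"
    (is "?J = four_block_mat ?rr ?r\<theta> ?\<theta>r ?\<theta>\<theta>")
proof -
  let ?F = "polar_field N A \<beta> \<tau> \<omega>"
  let ?\<delta> = "\<lambda>i n. if n = i then 1 else (0::real)"
  have xr: "x j = R" if "j \<le> N" for j using that by (simp add: x_def polar_state_def)
  have x\<theta>: "x (N + j) = phase N j + c" if "j \<ge> 1" for j using that by (simp add: x_def polar_state_def)
  have x\<theta>': "x (j + N) = phase N j + c" if "j \<ge> 1" for j using x\<theta>[OF that] by (simp add: add.commute)
  have row: "(\<Sum>l=1..N. A j l) = (\<Sum>m<N. a m)"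
    "(\<Sum>l=1..N. A j l * cos (phase N l - phase N j)) = P"
    "(\<Sum>l=1..N. A j l * sin (phase N l - phase N j)) = W" if "j \<in> {1..N}" for j
    using circulant_row_sum[OF circ that, of "\<lambda>x c s. x"]
      circulant_row_sum[OF circ that, of "\<lambda>x c s. x * c"]
      circulant_row_sum[OF circ that, of "\<lambda>x c s. x * s"]
    by (simp_all add: P_def W_def)
  \<comment> \<open>Differentiating in the coordinate of oscillator \<open>i\<close> leaves one coupling term \<open>u i\<close> and, on the
    diagonal, a row sum.\<close>
  have pick: "(\<Sum>l=1..N. (if l = i then u l else 0) + (if j = i then v l else 0))
      = u i + (if j = i then (\<Sum>l=1..N. v l) else 0)" if "i \<in> {1..N}" for u v :: "nat \<Rightarrow> real" and i j :: nat
    using that by (simp add: sum.distrib)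
  have rr: "deriv (\<lambda>s. ?F (x(i := s)) j) (x i)
      = A j i * cos (phase N i - phase N j) + (if j = i then E else 0)"
    if ij: "i \<in> {1..N}" "j \<in> {1..N}" for i j
  proof -
    have "deriv (\<lambda>s. ?F (x(i := s)) j) (x i) = (\<Sum>l=1..N. A j l * (cos (x (N + l) - x (N + j)) * ?\<delta> i l
        - sin (x (N + l) - x (N + j)) * (?\<delta> i (N + l) - ?\<delta> i (N + j)) * x l - ?\<delta> i j))
        + 1 / \<tau> * (1 - 3 * (x j)\<^sup>2 / \<beta>\<^sup>2) * ?\<delta> i j"
      using ij by (intro polar_field_radius_partial) simp
    also have "(\<Sum>l=1..N. A j l * (cos (x (N + l) - x (N + j)) * ?\<delta> i l
        - sin (x (N + l) - x (N + j)) * (?\<delta> i (N + l) - ?\<delta> i (N + j)) * x l - ?\<delta> i j))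
      = (\<Sum>l=1..N. (if l = i then A j l * cos (phase N l - phase N j) else 0)
          + (if j = i then - A j l else 0))"
      using ij by (intro sum.cong refl) (auto simp: x\<theta> x\<theta>' algebra_simps)
    finally show ?thesis
      using ij unfolding pick[OF ij(1)] sum_negf row[OF ij(2)] by (simp add: E_def xr del: fun_upd_apply)
  qed
  have r\<theta>: "deriv (\<lambda>s. ?F (x(N + i := s)) j) (x (N + i))
      = - R * (A j i * sin (phase N i - phase N j)) + (if j = i then R * W else 0)"
    if ij: "i \<in> {1..N}" "j \<in> {1..N}" for i j
  proof -
    have "deriv (\<lambda>s. ?F (x(N + i := s)) j) (x (N + i)) = (\<Sum>l=1..N. A j l * (cos (x (N + l) - x (N + j)) * ?\<delta> (N + i) l
        - sin (x (N + l) - x (N + j)) * (?\<delta> (N + i) (N + l) - ?\<delta> (N + i) (N + j)) * x l - ?\<delta> (N + i) j))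
        + 1 / \<tau> * (1 - 3 * (x j)\<^sup>2 / \<beta>\<^sup>2) * ?\<delta> (N + i) j"
      using ij by (intro polar_field_radius_partial) simp
    also have "(\<Sum>l=1..N. A j l * (cos (x (N + l) - x (N + j)) * ?\<delta> (N + i) l
        - sin (x (N + l) - x (N + j)) * (?\<delta> (N + i) (N + l) - ?\<delta> (N + i) (N + j)) * x l - ?\<delta> (N + i) j))
      = (\<Sum>l=1..N. (if l = i then - R * (A j l * sin (phase N l - phase N j)) else 0)
          + (if j = i then R * (A j l * sin (phase N l - phase N j)) else 0))"
      using ij by (intro sum.cong refl) (auto simp: x\<theta> x\<theta>' xr algebra_simps)
    finally show ?thesis
      using ij unfolding pick[OF ij(1)] sum_distrib_left[symmetric] row[OF ij(2)] by (simp del: fun_upd_apply)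
  qed
  have \<theta>r: "deriv (\<lambda>s. ?F (x(i := s)) (N + j)) (x i)
      = 1 / R * (A j i * sin (phase N i - phase N j)) + (if j = i then - W / R else 0)"
    if ij: "i \<in> {1..N}" "j \<in> {1..N}" for i j
  proof -
    have "deriv (\<lambda>s. ?F (x(i := s)) (N + j)) (x i)
      = (\<Sum>l=1..N. A j l * ((?\<delta> i l * x j - x l * ?\<delta> i j) / (x j * x j) * sin (x (N + l) - x (N + j))
        + x l / x j * (cos (x (N + l) - x (N + j)) * (?\<delta> i (N + l) - ?\<delta> i (N + j)))))"
      using ij R by (intro polar_field_angle_partial) (simp_all add: xr)
    also have "\<dots> = (\<Sum>l=1..N. (if l = i then 1 / R * (A j l * sin (phase N l - phase N j)) else 0)
          + (if j = i then - (1 / R) * (A j l * sin (phase N l - phase N j)) else 0))"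
      using ij R by (intro sum.cong refl) (auto simp: x\<theta> x\<theta>' xr field_simps)
    finally show ?thesis
      using ij unfolding pick[OF ij(1)] sum_distrib_left[symmetric] row[OF ij(2)] by (simp del: fun_upd_apply)
  qed
  have \<theta>\<theta>: "deriv (\<lambda>s. ?F (x(N + i := s)) (N + j)) (x (N + i))
      = A j i * cos (phase N i - phase N j) + (if j = i then - P else 0)"
    if ij: "i \<in> {1..N}" "j \<in> {1..N}" for i j
  proof -
    have "deriv (\<lambda>s. ?F (x(N + i := s)) (N + j)) (x (N + i))
      = (\<Sum>l=1..N. A j l * ((?\<delta> (N + i) l * x j - x l * ?\<delta> (N + i) j) / (x j * x j) * sin (x (N + l) - x (N + j))
        + x l / x j * (cos (x (N + l) - x (N + j)) * (?\<delta> (N + i) (N + l) - ?\<delta> (N + i) (N + j)))))"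
      using ij R by (intro polar_field_angle_partial) (simp_all add: xr)
    also have "\<dots> = (\<Sum>l=1..N. (if l = i then A j l * cos (phase N l - phase N j) else 0)
          + (if j = i then - (A j l * cos (phase N l - phase N j)) else 0))"
      using ij R by (intro sum.cong refl) (auto simp: x\<theta> x\<theta>' xr field_simps)
    finally show ?thesis
      using ij unfolding pick[OF ij(1)] sum_negf row[OF ij(2)] by (simp del: fun_upd_apply)
  qed
  have entry: "A (Suc p) (Suc q) * cos (phase N (Suc q) - phase N (Suc p))
        = a (nat ((int q - int p) mod int N)) * cos (phase N (nat ((int q - int p) mod int N)))"
      "A (Suc p) (Suc q) * sin (phase N (Suc q) - phase N (Suc p))
        = a (nat ((int q - int p) mod int N)) * sin (phase N (nat ((int q - int p) mod int N)))"
    if "p < N" "q < N" for p q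
    using that circulant_entry[OF circ, of "Suc p" "Suc q"]
      cos_sin_phase_mod[of N "Suc q" "Suc p"] by simp_all
  show ?thesis
  proof (rule eq_four_blockI[where N = N])
    fix p q assume pq: "p < N" "q < N"
    note simps = jacobian_def entry shift_eq_0_iff
    show "?J $$ (p, q) = ?rr $$ (p, q)"
      using rr[of "Suc q" "Suc p"] pq by (simp add: simps del: fun_upd_apply)
    show "?J $$ (p, N + q) = ?r\<theta> $$ (p, q)"
      using r\<theta>[of "Suc q" "Suc p"] pq by (simp add: simps del: fun_upd_apply)
    show "?J $$ (N + p, q) = ?\<theta>r $$ (p, q)"
      using \<theta>r[of "Suc q" "Suc p"] pq by (simp add: simps del: fun_upd_apply)
    show "?J $$ (N + p, N + q) = ?\<theta>\<theta> $$ (p, q)"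
      using \<theta>\<theta>[of "Suc q" "Suc p"] pq by (simp add: simps del: fun_upd_apply)
  qed (simp_all add: jacobian_def mult_2)
qed

text \<open>Changing the generator at residue $0$ shifts every eigenvalue by the same amount.\<close>
lemma circulant_symbol_shifted:
  assumes "N > 0"
  shows "circulant_symbol N (\<lambda>m. of_real (r * g m + (if m = 0 then e else 0))) k
       = of_real r * circulant_symbol N (\<lambda>m. of_real (g m)) k + of_real e"
proof -
  have "circulant_symbol N (\<lambda>m. of_real (r * g m + (if m = 0 then e else 0))) k
      = (\<Sum>m<N. of_real r * (of_real (g m) * cis (real k * phase N m)) + (if m = 0 then of_real e else 0))"
    unfolding circulant_symbol_def by (intro sum.cong refl) (auto simp: algebra_simps)
  then show ?thesis
    using assms by (simp add: sum.distrib sum_distrib_left circulant_symbol_def)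
qed

lemma twisted_state_equilibrium:
  assumes circ: "circulant N a A" and "R > 0"
    and balance: "1 / \<tau> * (1 - R\<^sup>2 / \<beta>\<^sup>2) = (\<Sum>l=1..N-1. a l) - (\<Sum>l=1..N-1. a l * cos (phase N l))"
    and \<omega>: "\<omega> = (\<Sum>l=1..N-1. a l * sin (phase N l))"
    and i: "i \<in> {1..2 * N}"
  shows "polar_field N A \<beta> \<tau> \<omega> (polar_state N (\<lambda>j. R) (\<lambda>j. phase N j + c)) i = 0"
proof (cases "i \<le> N")
  case True
  then have i: "i \<in> {1..N}" "N > 0" using i by auto
  have "(\<Sum>l=1..N. A i l * (cos (phase N l - phase N i) * R - R))
      = (\<Sum>m<N. a m * (cos (phase N m) * R - R))"
    using circulant_row_sum[OF circ i(1), of "\<lambda>x c s. x * (c * R - R)"] .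
  also have "\<dots> = (\<Sum>m<N. a m * cos (phase N m) - a m) * R"
    unfolding sum_distrib_right by (intro sum.cong refl) (simp add: algebra_simps)
  also have "\<dots> = - ((\<Sum>l=1..N-1. a l) - (\<Sum>l=1..N-1. a l * cos (phase N l))) * R"
    by (simp add: sum_lessThan_split_0[OF i(2)] sum_subtractf)
  finally have "(\<Sum>l=1..N. A i l * (cos (phase N l - phase N i) * R - R))
      + 1 / \<tau> * (1 - R\<^sup>2 / \<beta>\<^sup>2) * R = 0"
    unfolding balance by (simp add: algebra_simps)
  then show ?thesis
    using i by (simp add: polar_field_def polar_state_def)
next
  case False
  then obtain j where ij: "i = N + j" and j: "j \<in> {1..N}"
    using i by (intro that[of "i - N"]) auto
  then have N: "N > 0" by simp
  have "(\<Sum>l=1..N. A j l * sin (phase N l - phase N j)) = \<omega>"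
    using circulant_row_sum[OF circ j, of "\<lambda>x c s. x * s"]
    by (simp add: sum_lessThan_split_0[OF N] \<omega>)
  then show ?thesis
    using j \<open>R > 0\<close> by (simp add: polar_field_def polar_state_def ij)
qed

text \<open>The amplitude equation turns the radial diagonal correction \<open>E\<close> into $-C_0 - m$, and the factors
  $R$ and $1/R$ of the two off-diagonal blocks cancel in their product.  The mode quadratics thus take
  the form $(x - p_k + m)(x - p_k) + q_k^2$ with $p_k = C_k - C_0$ and $q_k = S_k - S_0$.\<close>
lemma twisted_state_linearly_stable:
  fixes N :: nat and a :: "nat \<Rightarrow> real" and A :: "nat \<Rightarrow> nat \<Rightarrow> real" and d \<rho> \<omega> \<beta> \<tau> R c :: real
  defines "C \<equiv> circulant_symbol N (\<lambda>m. of_real (a m * cos (phase N m)))"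
    and "S \<equiv> circulant_symbol N (\<lambda>m. of_real (a m * sin (phase N m)))"
    and "m \<equiv> 2 / \<tau> - 2 * (d - \<rho>)"
  assumes "N > 0" and circ: "circulant N a A" and "R > 0" and "m > 0"
    and d: "d = (\<Sum>l=1..N-1. a l)"
    and \<rho>: "\<rho> = (\<Sum>l=1..N-1. a l * cos (phase N l))"
    and \<omega>: "\<omega> = (\<Sum>l=1..N-1. a l * sin (phase N l))"
    and balance: "1 / \<tau> * (1 - R\<^sup>2 / \<beta>\<^sup>2) = d - \<rho>"
    and gap: "\<forall>k\<in>{1..N-1}. Re (C k - C 0) < 0 \<and> (cmod (S k - S 0))\<^sup>2 < m * (- Re (C k - C 0))"
  shows "linearly_stable N A \<beta> \<tau> \<omega> (\<lambda>j. R) (\<lambda>j. phase N j + c)"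
proof -
  define x where "x = polar_state N (\<lambda>j. R) (\<lambda>j. phase N j + c)"
  define E where "E = 1 / \<tau> * (1 - 3 * R\<^sup>2 / \<beta>\<^sup>2) - (\<Sum>m<N. a m)"
  define P where "P = (\<Sum>m<N. a m * cos (phase N m))"
  define W where "W = (\<Sum>m<N. a m * sin (phase N m))"
  let ?J = "jacobian (2 * N) (polar_field N A \<beta> \<tau> \<omega>) x"
  have C0: "C 0 = of_real P" and S0: "S 0 = of_real W"
    by (simp_all add: C_def S_def P_def W_def circulant_symbol_def)
  have E: "E = - P - m"
  proof -
    have "1 / \<tau> * (1 - 3 * R\<^sup>2 / \<beta>\<^sup>2) = 3 * (1 / \<tau> * (1 - R\<^sup>2 / \<beta>\<^sup>2)) - 2 / \<tau>"
      by (simp add: diff_divide_distrib algebra_simps)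
    then have "1 / \<tau> * (1 - 3 * R\<^sup>2 / \<beta>\<^sup>2) = 3 * (d - \<rho>) - 2 / \<tau>"
      unfolding balance .
    then show ?thesis
      by (simp add: E_def P_def m_def sum_lessThan_split_0[OF \<open>N > 0\<close>] d \<rho>)
  qed
  note symbol = circulant_symbol_shifted[OF \<open>N > 0\<close>]
  have "char_poly ?J = (\<Prod>k<N. [:- (C k + of_real E), 1:] * [:- (C k - of_real P), 1:]
      - [:(- of_real R * S k + of_real (R * W)) * (of_real (1 / R) * S k + of_real (- W / R)):])"
    using symbol[of 1 "\<lambda>m. a m * cos (phase N m)" E] symbol[of 1 "\<lambda>m. a m * cos (phase N m)" "- P"]
      symbol[of "- R" "\<lambda>m. a m * sin (phase N m)" "R * W"]
      symbol[of "1 / R" "\<lambda>m. a m * sin (phase N m)" "- W / R"]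
    unfolding x_def twisted_state_jacobian[OF circ \<open>R > 0\<close>] char_poly_block_circulant
      E_def[symmetric] P_def[symmetric] W_def[symmetric]
    by (simp only: C_def S_def mult_1_left of_real_1 of_real_minus diff_conv_add_uminus)
  also have "\<dots> = (\<Prod>k<N. [:- ((C k - C 0) - of_real m), 1:] * [:- (C k - C 0), 1:] + [:(S k - S 0)\<^sup>2:])"
  proof (rule prod.cong[OF refl])
    fix k
    have "(- of_real R * S k + of_real (R * W)) * (of_real (1 / R) * S k + of_real (- W / R))
        = - ((S k - S 0)\<^sup>2)"
      using \<open>R > 0\<close> by (simp add: S0 power2_eq_square field_simps)
    then show "[:- (C k + of_real E), 1:] * [:- (C k - of_real P), 1:]
      - [:(- of_real R * S k + of_real (R * W)) * (of_real (1 / R) * S k + of_real (- W / R)):]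
      = [:- ((C k - C 0) - of_real m), 1:] * [:- (C k - C 0), 1:] + [:(S k - S 0)\<^sup>2:]"
      by (simp add: C0 E)
  qed
  finally have cp: "char_poly ?J = (\<Prod>k<N. [:- ((C k - C 0) - of_real m), 1:] * [:- (C k - C 0), 1:]
      + [:(S k - S 0)\<^sup>2:])" .
  have J: "?J \<in> carrier_mat (2 * N) (2 * N)" by (simp add: jacobian_def)
  note spectrum = spectrum_of_modes[OF J \<open>N > 0\<close> \<open>m > 0\<close> cp _ _ gap]
  have "\<forall>i\<in>{1..2 * N}. polar_field N A \<beta> \<tau> \<omega> x i = 0"
    using twisted_state_equilibrium[OF circ \<open>R > 0\<close> balance[unfolded d \<rho>] \<omega>] by (simp add: x_def)
  then show ?thesis
    using spectrum \<open>R > 0\<close> by (simp add: linearly_stable_def x_def[symmetric])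
qed

theorem theorem2:
  fixes N :: nat and \<beta> d \<rho> \<omega> :: real and a :: "nat \<Rightarrow> real" and A :: "nat \<Rightarrow> nat \<Rightarrow> real"
  assumes "N \<ge> 5"
    and "\<beta> > 0"
    and "circulant N a A"
    and "\<forall>l\<in>{0..N-1}. a l \<ge> 0"
    and "cone_condition N a"
    and "d = (\<Sum>l=1..N-1. a l)"
    and "\<rho> = (\<Sum>l=1..N-1. a l * cos (phase N l))"
    and "\<omega> = (\<Sum>l=1..N-1. a l * sin (phase N l))"
  shows "\<exists>\<tau>\<^sub>2. 0 < \<tau>\<^sub>2 \<and> \<tau>\<^sub>2 \<le> inverse (d - \<rho>) \<and>
           (\<forall>\<tau> c. 0 < \<tau> \<and> \<tau> \<le> \<tau>\<^sub>2 \<longrightarrow>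
              (let R = \<beta> * sqrt (\<tau> * (\<rho> - d + 1 / \<tau>));
                   r = (\<lambda>j. R);
                   \<theta> = (\<lambda>j. phase N j + c)
               in stuart_landau_solution N A \<beta> \<tau> (rotating_state r \<theta> \<omega>) \<and>
                  linearly_stable N A \<beta> \<tau> \<omega> r \<theta>))"
proof -
  have N: "N > 0" using assms(1) by simp
  define C where "C = circulant_symbol N (\<lambda>m. of_real (a m * cos (phase N m)))"
  define S where "S = circulant_symbol N (\<lambda>m. of_real (a m * sin (phase N m)))"
  \<comment> \<open>Adding up the ratios bounds each of them; the summand 1 makes the bound strict.\<close>
  define M where "M = 1 + (\<Sum>k=1..N-1. (cmod (S k - S 0))\<^sup>2 / (- Re (C k - C 0)))"
  have decay: "Re (C k - C 0) < 0" if "k \<in> {1..N-1}" for k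
  proof -
    have "- Re (C k - C 0) = (\<Sum>l=1..N-1. a l * cos (phase N l) * (1 - cos (real k * phase N l)))"
      by (simp add: C_def circulant_symbol_def sum_lessThan_split_0[OF N] right_diff_distrib sum_subtractf)
    then show ?thesis using assms(5) that unfolding cone_condition_def by fastforce
  qed
  \<comment> \<open>If \<open>d - \<rho>\<close> vanished, every weight \<open>a l\<close> with \<open>l \<noteq> 0\<close> would vanish, and so would the left
    side of the cone condition.\<close>
  have drho: "d - \<rho> > 0"
  proof -
    have diff: "d - \<rho> = (\<Sum>l=1..N-1. a l * (1 - cos (phase N l)))"
      by (simp add: assms(6,7) right_diff_distrib sum_subtractf)
    have nonneg: "a l * (1 - cos (phase N l)) \<ge> 0" if "l \<in> {1..N-1}" for l
      using assms(4) that by simp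
    have "a l = 0" if z: "d - \<rho> = 0" and l: "l \<in> {1..N-1}" for l
    proof -
      have "a l * (1 - cos (phase N l)) = 0"
        using sum_nonneg_0[OF _ nonneg z[unfolded diff] l] by simp
      moreover have "cos (phase N l) \<noteq> 1"
      proof
        assume "cos (phase N l) = 1"
        then obtain t :: int where "phase N l = of_int t * 2 * pi"
          using cos_one_2pi_int by auto
        then have "(2 * pi) * real l = (2 * pi) * (of_int t * real N)"
          using N by (simp add: phase_def field_simps)
        then have "real_of_int (int l) = of_int (t * int N)"
          by (subst (asm) mult_cancel_left) simp
        then have "int l = t * int N" by (simp only: of_int_eq_iff)
        then have "int N dvd int l" by simp
        then have "N \<le> l" using l by (intro dvd_imp_le) auto
        then show False using l by auto
      qed
      ultimately show ?thesis by simp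
    qed
    then have "d - \<rho> \<noteq> 0"
      using assms(1,5) unfolding cone_condition_def by (force dest: bspec[of _ _ 1])
    moreover have "d - \<rho> \<ge> 0" unfolding diff by (intro sum_nonneg nonneg)
    ultimately show ?thesis by simp
  qed
  have terms: "(cmod (S k - S 0))\<^sup>2 / (- Re (C k - C 0)) \<ge> 0" if "k \<in> {1..N-1}" for k
    using decay[OF that] by (intro divide_nonneg_nonneg) auto
  have "M \<ge> 1" unfolding M_def le_add_same_cancel1 by (intro sum_nonneg terms)
  \<comment> \<open>The value of \<open>\<tau>\<close> at which \<open>2 / \<tau> - 2 * (d - \<rho>)\<close> equals \<open>M\<close>.  As \<open>M > 0\<close>, it lies strictly below
    \<open>inverse (d - \<rho>)\<close>, which keeps \<open>R\<close> positive.\<close>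
  define \<tau>\<^sub>2 where "\<tau>\<^sub>2 = 2 / (M + 2 * (d - \<rho>))"
  have "\<tau>\<^sub>2 > 0" using drho \<open>M \<ge> 1\<close> by (simp add: \<tau>\<^sub>2_def)
  moreover have "\<tau>\<^sub>2 \<le> inverse (d - \<rho>)"
    using drho \<open>M \<ge> 1\<close> by (simp add: \<tau>\<^sub>2_def field_simps)
  moreover have "stuart_landau_solution N A \<beta> \<tau> (rotating_state (\<lambda>j. R) (\<lambda>j. phase N j + c) \<omega>) \<and>
      linearly_stable N A \<beta> \<tau> \<omega> (\<lambda>j. R) (\<lambda>j. phase N j + c)"
    if \<tau>: "0 < \<tau>" "\<tau> \<le> \<tau>\<^sub>2" and R: "R = \<beta> * sqrt (\<tau> * (\<rho> - d + 1 / \<tau>))" for \<tau> c R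
  proof -
    have "\<tau> * (M + 2 * (d - \<rho>)) \<le> 2"
      using \<tau>(2) drho \<open>M \<ge> 1\<close> by (simp add: \<tau>\<^sub>2_def field_simps)
    then have m: "M \<le> 2 / \<tau> - 2 * (d - \<rho>)"
      using \<tau>(1) by (simp add: field_simps)
    then have amp: "\<tau> * (\<rho> - d + 1 / \<tau>) > 0"
      using \<tau>(1) \<open>M \<ge> 1\<close> by simp
    then have "R > 0" using assms(2) by (simp add: R)
    have "R\<^sup>2 / \<beta>\<^sup>2 = \<tau> * (\<rho> - d + 1 / \<tau>)"
      using amp assms(2) by (simp add: R power_mult_distrib)
    also have "\<dots> = 1 - \<tau> * (d - \<rho>)"
      using \<tau>(1) by (simp add: algebra_simps)
    finally have balance: "1 / \<tau> * (1 - R\<^sup>2 / \<beta>\<^sup>2) = d - \<rho>"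
      using \<tau>(1) by simp
    have gap: "(cmod (S k - S 0))\<^sup>2 < (2 / \<tau> - 2 * (d - \<rho>)) * (- Re (C k - C 0))"
      if k: "k \<in> {1..N-1}" for k
    proof -
      have "(cmod (S k - S 0))\<^sup>2 / (- Re (C k - C 0)) < M"
        using member_le_sum[OF k, of "\<lambda>k. (cmod (S k - S 0))\<^sup>2 / (- Re (C k - C 0))"] terms
        unfolding M_def by fastforce
      then have "(cmod (S k - S 0))\<^sup>2 / (- Re (C k - C 0)) < 2 / \<tau> - 2 * (d - \<rho>)"
        using m by linarith
      then show ?thesis using decay[OF k] by (subst (asm) pos_divide_less_eq) auto
    qed
    have "stuart_landau_solution N A \<beta> \<tau> (rotating_state (\<lambda>j. R) (\<lambda>j. phase N j + c) \<omega>)"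
      by (rule twisted_state_solution[OF assms(3) balance[unfolded assms(6,7)] assms(8)])
    moreover have "linearly_stable N A \<beta> \<tau> \<omega> (\<lambda>j. R) (\<lambda>j. phase N j + c)"
      using decay gap m \<open>M \<ge> 1\<close> unfolding C_def S_def
      by (intro twisted_state_linearly_stable[OF N assms(3) \<open>R > 0\<close> _ assms(6-8) balance]) auto
    ultimately show ?thesis by simp
  qed
  ultimately show ?thesis unfolding Let_def by blast
qed

end
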